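(* In the weighted graph setting described in the context, assume that the graph $\mathcal G^-$ with node set $\partial\Omega\cup\Omega^-$ and with edges those edges $e$ of $\mathcal G$ between these nodes for which $\sigma^-(e)>0$ is connected. Then the Neumann-Poincaré operator $D'$ has eigenvalue $-\frac12$, with associated eigenspace spanned by $S^{-1}1$, where $1\in\mathbb R^{|\partial\Omega|}$ is the vector of all ones.
   Context: Graph. $\mathcal G=(\mathcal V,\mathcal E)$ is a finite connected undirected graph without self-edges. $\mathcal V$ is partitioned into four nonempty disjoint sets $B,\Omega^+,\partial\Omega,\Omega^-$ such that, among pairs of distinct sets of the partition, the only ones joined by at least one edge are $\{B,\Omega^+\}$, $\{\Omega^+,\partial\Omega\}$, $\{\partial\Omega,\Omega^-\}$ (so there are no edges between $B$ and $\partial\Omega$, $B$ and $\Omega^-$, or $\Omega^+$ and $\Omega^-$). Put $\mathcal V^\circ=\mathcal V\setminus B$. Laplacian. The discrete gradient $\nabla$ is the $|\mathcal E|\times|\mathcal V|$ matrix with $(\nabla u)_k=u_i-u_j$, where $i,j$ are the endpoints of edge $k$ in a fixed order. For $s\in[0,\infty)^{|\mathcal E|}$, $L(s)=\nabla^T\mathrm{diag}(s)\nabla$. A conductivity $\sigma\in(0,\infty)^{|\mathcal E|}$ is fixed. $L[X,Y]$ denotes the submatrix with rows $X$, columns $Y$; $R_X$ is the $|X|\times|\mathcal V|$ matrix with $R_Xu=u|_X$. Green function. $G=R_{\mathcal V^\circ}^T\,L(\sigma)[\mathcal V^\circ,\mathcal V^\circ]^{-1}R_{\mathcal V^\circ}$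 (the inverse exists since $\mathcal G$ is connected). Edge partition of unity. Let $\mathcal E^+$ be the edges with at least one node in $B\cup\Omega^+$ and $\mathcal E^-$ the edges with at least one node in $\Omega^-$. Fix any $p^+,p^-\in[0,1]^{|\mathcal E|}$ with $p^++p^-=1$, $p^+|_{\mathcal E^+}=1$, $p^-|_{\mathcal E^-}=1$. Set $\sigma^\pm=p^\pm\sigma$ (componentwise), so $L(\sigma)=L(\sigma^+)+L(\sigma^-)$. Operators. $\gamma_0=R_{\partial\Omega}$, $\gamma_1^\pm=\mp R_{\partial\Omega}L(\sigma^\pm)$, $\mathcal S=G\gamma_0^T$. The single layer operator is $S=\gamma_0\mathcal S$ (an invertible $|\partial\Omega|\times|\partial\Omega|$ matrix) and the Neumann-Poincaré (adjoint double layer) operator is $D'=\frac12(\gamma_1^++\gamma_1^-)\mathcal S$. *)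

theory Defs
  imports
    "HOL-Library.Disjoint_Sets"
    "Graph_Theory.Graph_Theory"
    "Jordan_Normal_Form.Matrix"
    "Jordan_Normal_Form.DL_Submatrix"
    "Jordan_Normal_Form.Gauss_Jordan_Elimination"
    "Jordan_Normal_Form.Char_Poly"
begin

text \<open>
  An undirected graph with a fixed order of the endpoints of each edge is a digraph with
  one arc per edge; the tail is the first endpoint and the head the second one.
  Connectedness is that of the underlying undirected graph, which is what \<^const>\<open>connected\<close>
  from the graph library expresses. Vertices and edges are numbered from 0, so that they can
  serve as matrix indices.
\<close>

definition edge_ends :: "('a, 'b) pre_digraph \<Rightarrow> 'b \<Rightarrow> 'a set" where
  "edge_ends G e = {tail G e, head G e}"

definition joined :: "('a, 'b) pre_digraph \<Rightarrow> 'a set \<Rightarrow> 'a set \<Rightarrow> bool" where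
  "joined G X Y \<longleftrightarrow> (\<exists>e\<in>arcs G. \<exists>x\<in>X. \<exists>y\<in>Y. edge_ends G e = {x, y})"

text \<open>
  The sets \<open>\<Omega>p\<close>, \<open>\<Gamma>\<close>, \<open>\<Omega>m\<close> stand for $\Omega^+$, $\partial\Omega$, $\Omega^-$, and \<open>pp\<close>, \<open>pm\<close>
  for $p^+$, $p^-$.
\<close>

locale conductivity_network =
  fin_digraph G + loopfree_digraph G for G :: "(nat, nat) pre_digraph" +
  fixes B \<Omega>p \<Gamma> \<Omega>m :: "nat set" and \<sigma> pp pm :: "real vec"
  assumes verts_numbered: "verts G = {0..<card (verts G)}"
    and arcs_numbered: "arcs G = {0..<card (arcs G)}"
    and no_parallel_edges:
      "\<And>e f. \<lbrakk>e \<in> arcs G; f \<in> arcs G; edge_ends G e = edge_ends G f\<rbrakk> \<Longrightarrow> e = f"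
    and connected_graph: "connected G"
    and partition: "partition_on (verts G) {B, \<Omega>p, \<Gamma>, \<Omega>m}"
    and distinct_parts: "distinct [B, \<Omega>p, \<Gamma>, \<Omega>m]"
    and joined_parts:
      "\<And>X Y. \<lbrakk>X \<in> {B, \<Omega>p, \<Gamma>, \<Omega>m}; Y \<in> {B, \<Omega>p, \<Gamma>, \<Omega>m}; X \<noteq> Y\<rbrakk> \<Longrightarrow>
        joined G X Y \<longleftrightarrow> {X, Y} \<in> {{B, \<Omega>p}, {\<Omega>p, \<Gamma>}, {\<Gamma>, \<Omega>m}}"
    and conductivity_carrier: "\<sigma> \<in> carrier_vec (card (arcs G))"
    and conductivity_pos: "\<And>e. e \<in> arcs G \<Longrightarrow> 0 < \<sigma> $ e"
    and pp_carrier: "pp \<in> carrier_vec (card (arcs G))"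
    and pm_carrier: "pm \<in> carrier_vec (card (arcs G))"
    and pp_range: "\<And>e. e \<in> arcs G \<Longrightarrow> pp $ e \<in> {0..1}"
    and pm_range: "\<And>e. e \<in> arcs G \<Longrightarrow> pm $ e \<in> {0..1}"
    and pp_pm_sum: "\<And>e. e \<in> arcs G \<Longrightarrow> pp $ e + pm $ e = 1"
    and pp_one: "\<And>e. \<lbrakk>e \<in> arcs G; edge_ends G e \<inter> (B \<union> \<Omega>p) \<noteq> {}\<rbrakk> \<Longrightarrow> pp $ e = 1"
    and pm_one: "\<And>e. \<lbrakk>e \<in> arcs G; edge_ends G e \<inter> \<Omega>m \<noteq> {}\<rbrakk> \<Longrightarrow> pm $ e = 1"

definition gradient_mat :: "(nat, nat) pre_digraph \<Rightarrow> real mat" where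
  "gradient_mat G = mat (card (arcs G)) (card (verts G))
     (\<lambda>(e, v). if v = tail G e then 1 else if v = head G e then -1 else 0)"

definition laplacian :: "(nat, nat) pre_digraph \<Rightarrow> real vec \<Rightarrow> real mat" where
  "laplacian G s =
     transpose_mat (gradient_mat G) * mat_diag (card (arcs G)) (\<lambda>e. s $ e) * gradient_mat G"

text \<open>
  Vectors on a set \<open>X\<close> of vertices are indexed by position in the increasing enumeration of \<open>X\<close>,
  as in \<^const>\<open>submatrix\<close>.
\<close>

definition restr :: "(nat, nat) pre_digraph \<Rightarrow> nat set \<Rightarrow> real mat" where
  "restr G X = mat (card X) (card (verts G)) (\<lambda>(i, v). if v = pick X i then 1 else 0)"

text \<open>The value is unspecified for singular matrices.\<close>

definition mat_inv :: "real mat \<Rightarrow> real mat" where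
  "mat_inv A = the (mat_inverse A)"

lemma mat_inv:
  assumes "A \<in> carrier_mat n n" "invertible_mat A"
  shows "mat_inv A \<in> carrier_mat n n" "A * mat_inv A = 1\<^sub>m n" "mat_inv A * A = 1\<^sub>m n"
proof -
  obtain C where C: "inverts_mat A C" "inverts_mat C A"
    using assms(2) by (auto simp: invertible_mat_def)
  have "dim_row C = n"
    using C(2) assms(1)
    by (metis carrier_matD(2) index_mult_mat(3) index_one_mat(3) inverts_mat_def)
  moreover have "dim_col C = n"
    using C(1) assms(1)
    by (metis carrier_matD(1) index_mult_mat(3) index_one_mat(3) inverts_mat_def)
  ultimately have "A \<in> Units (ring_mat TYPE(real) n ())"
    using C assms(1) by (auto simp: Units_def ring_mat_def inverts_mat_def intro!: bexI[of _ C])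
  then obtain D where D: "mat_inverse A = Some D"
    using mat_inverse(1)[OF assms(1), of "()"] by (cases "mat_inverse A") auto
  show "mat_inv A \<in> carrier_mat n n" "A * mat_inv A = 1\<^sub>m n" "mat_inv A * A = 1\<^sub>m n"
    using mat_inverse(2)[OF assms(1) D] D by (auto simp: mat_inv_def)
qed

definition green_mat :: "(nat, nat) pre_digraph \<Rightarrow> nat set \<Rightarrow> real vec \<Rightarrow> real mat" where
  "green_mat G B \<sigma> =
     (let V0 = verts G - B in
        transpose_mat (restr G V0) * mat_inv (submatrix (laplacian G \<sigma>) V0 V0) * restr G V0)"

text \<open>
  In the normal derivatives below, \<open>sp\<close> and \<open>sm\<close> are
  $\sigma^+ = p^+\sigma$ and $\sigma^- = p^-\sigma$.
\<close>

definition gamma0 :: "(nat, nat) pre_digraph \<Rightarrow> nat set \<Rightarrow> real mat" where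
  "gamma0 G \<Gamma> = restr G \<Gamma>"

definition gamma1_plus :: "(nat, nat) pre_digraph \<Rightarrow> nat set \<Rightarrow> real vec \<Rightarrow> real mat" where
  "gamma1_plus G \<Gamma> sp = - (restr G \<Gamma> * laplacian G sp)"

definition gamma1_minus :: "(nat, nat) pre_digraph \<Rightarrow> nat set \<Rightarrow> real vec \<Rightarrow> real mat" where
  "gamma1_minus G \<Gamma> sm = restr G \<Gamma> * laplacian G sm"

definition layer_potential ::
    "(nat, nat) pre_digraph \<Rightarrow> nat set \<Rightarrow> nat set \<Rightarrow> real vec \<Rightarrow> real mat" where
  "layer_potential G B \<Gamma> \<sigma> = green_mat G B \<sigma> * transpose_mat (gamma0 G \<Gamma>)"

definition single_layer ::
    "(nat, nat) pre_digraph \<Rightarrow> nat set \<Rightarrow> nat set \<Rightarrow> real vec \<Rightarrow> real mat" where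
  "single_layer G B \<Gamma> \<sigma> = gamma0 G \<Gamma> * layer_potential G B \<Gamma> \<sigma>"

definition neumann_poincare ::
    "(nat, nat) pre_digraph \<Rightarrow> nat set \<Rightarrow> nat set \<Rightarrow>
     real vec \<Rightarrow> real vec \<Rightarrow> real vec \<Rightarrow> real mat" where
  "neumann_poincare G B \<Gamma> \<sigma> pp pm =
     (1/2) \<cdot>\<^sub>m (gamma1_plus G \<Gamma> (component_mult pp \<sigma>) + gamma1_minus G \<Gamma> (component_mult pm \<sigma>))
       * layer_potential G B \<Gamma> \<sigma>"

definition minus_graph ::
    "(nat, nat) pre_digraph \<Rightarrow> nat set \<Rightarrow> nat set \<Rightarrow> real vec \<Rightarrow> (nat, nat) pre_digraph" where
  "minus_graph G \<Gamma> \<Omega>m sm =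
     \<lparr>verts = \<Gamma> \<union> \<Omega>m,
      arcs = {e \<in> arcs G. edge_ends G e \<subseteq> \<Gamma> \<union> \<Omega>m \<and> 0 < sm $ e},
      tail = tail G, head = head G\<rparr>"

definition eigenspace :: "real mat \<Rightarrow> real \<Rightarrow> real vec set" where
  "eigenspace A k = {v \<in> carrier_vec (dim_row A). A *\<^sub>v v = k \<cdot>\<^sub>v v}"

definition ones_vec :: "nat \<Rightarrow> real vec" where
  "ones_vec n = vec n (\<lambda>_. 1)"

end

theory Submission
  imports Defs
begin

text \<open>
  Let \<open>u\<close> be the single layer potential of \<open>\<phi>\<close>. It vanishes on \<open>B\<close>, it is harmonic in \<open>\<Omega>p\<close> and
  \<open>\<Omega>m\<close>, and the jump of its normal derivative across \<open>\<Gamma>\<close> is \<open>\<phi>\<close>, so \<open>\<phi>\<close> is an eigenvector of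
  the Neumann-Poincare operator for $-1/2$ exactly if the inner normal derivative of \<open>u\<close>
  vanishes. As the Laplacian of the inner conductivity agrees with the full one in \<open>\<Omega>m\<close> and is
  zero in \<open>B \<union> \<Omega>p\<close>, the potential \<open>u\<close> then has zero inner energy and is constant on the
  connected graph \<open>\<Gamma> \<union> \<Omega>m\<close>. Conversely a potential that is constant on \<open>\<Gamma>\<close> is constant on
  \<open>\<Omega>m\<close>, by uniqueness of the Dirichlet problem. Constancy on \<open>\<Gamma>\<close> means that the single layer
  operator maps \<open>\<phi>\<close> to a multiple of the vector of ones.
\<close>

section \<open>Auxiliary facts on connected graphs, matrices and enumerations\<close>

text \<open>Reachability is taken in the symmetrised graph, so a path may follow arcs in either
  direction; each step preserves \<open>f\<close>, and induction on the path concludes.\<close>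

lemma connected_imp_constant:
  assumes "connected H"
    and step: "\<And>e. e \<in> arcs H \<Longrightarrow> f (tail H e) = f (head H e)"
    and "x \<in> verts H" "y \<in> verts H"
  shows "f x = f y"
proof -
  have "(x, y) \<in> rtrancl_on (verts H) (arcs_ends (with_proj (mk_symmetric H)))"
    using assms by (auto simp: connected_def strongly_connected_def reachable_def)
  then show ?thesis
    by (induction rule: rtrancl_on_induct) (auto simp: parcs_mk_symmetric dest!: step)
qed

text \<open>Over a field a trivial kernel forces a nonzero determinant. Energy arguments supply
  trivial kernels, for the reduced Laplacian and for the single layer operator.\<close>

lemma injective_imp_invertible_mat:
  fixes A :: "'a :: field mat"
  assumes A: "A \<in> carrier_mat n n"
    and inj: "\<And>x. \<lbrakk>x \<in> carrier_vec n; A *\<^sub>v x = 0\<^sub>v n\<rbrakk> \<Longrightarrow> x = 0\<^sub>v n"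
  shows "invertible_mat A"
proof -
  have "det A \<noteq> 0"
    using inj det_0_iff_vec_prod_zero_field[OF A] by blast
  from det_non_zero_imp_unit[OF A this, of "()"] A show ?thesis
    by (auto simp: Units_def ring_mat_def invertible_mat_def inverts_mat_def)
qed

lemma range_pick:
  assumes "finite X" "v \<in> X"
  obtains i where "i < card X" "v = pick X i"
proof
  \<comment> \<open>The position of \<open>v\<close> in the increasing enumeration is the number of
    smaller elements of \<open>X\<close>.\<close>
  show "card {a \<in> X. a < v} < card X"
    using assms by (intro psubset_card_mono) auto
  show "v = pick X (card {a \<in> X. a < v})"
    using pick_card_in_set[OF assms(2)] by simp
qed

lemma pick_eq_iff:
  assumes "i < card X" "j < card X"
  shows "pick X i = pick X j \<longleftrightarrow> i = j"
  using assms pick_mono[of i X j] pick_mono[of j X i] by (cases i j rule: linorder_cases) auto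

lemma sum_delta_mult:
  fixes f :: "'b \<Rightarrow> 'a :: semiring_1"
  assumes "finite S" "a \<in> S"
  shows "(\<Sum>v\<in>S. (if v = a then 1 else 0) * f v) = f a"
proof -
  have "(\<Sum>v\<in>S. (if v = a then 1 else 0) * f v) = (\<Sum>v\<in>S. if v = a then f v else 0)"
    by (intro sum.cong) auto
  then show ?thesis
    using assms by simp
qed

lemma smult_mat_mult_vec_index:
  fixes A :: "'a :: semiring_0 mat"
  assumes "A \<in> carrier_mat nr nc" "v \<in> carrier_vec nc" "i < nr"
  shows "((k \<cdot>\<^sub>m A) *\<^sub>v v) $ i = k * (A *\<^sub>v v) $ i"
  using assms by (simp add: scalar_prod_def sum_distrib_left mult.assoc)

lemma diff_mat_mult_vec_index:
  fixes A :: "'a :: ring mat"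
  assumes "A \<in> carrier_mat nr nc" "C \<in> carrier_mat nr nc" "v \<in> carrier_vec nc" "i < nr"
  shows "((- A + C) *\<^sub>v v) $ i = (C *\<^sub>v v) $ i - (A *\<^sub>v v) $ i"
  using assms by (simp add: scalar_prod_def algebra_simps sum_subtractf sum.distrib sum_negf)

section \<open>Restriction and gradient matrices\<close>

context conductivity_network
begin

abbreviation (input) "n \<equiv> card (verts G)"

lemma vertex_less_iff: "v \<in> verts G \<longleftrightarrow> v < n"
  by (subst verts_numbered) simp

lemma arc_less_iff: "e \<in> arcs G \<longleftrightarrow> e < card (arcs G)"
  by (subst arcs_numbered) simp

lemma tail_less [simp]: "e \<in> arcs G \<Longrightarrow> tail G e < n"
  and head_less [simp]: "e \<in> arcs G \<Longrightarrow> head G e < n"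
  by (simp_all flip: vertex_less_iff)

lemma finite_subset_verts: "X \<subseteq> verts G \<Longrightarrow> finite X"
  by (rule finite_subset[OF _ finite_verts])

lemma pick_less: "\<lbrakk>X \<subseteq> verts G; i < card X\<rbrakk> \<Longrightarrow> pick X i < n"
  using pick_in_set[of i X] by (auto simp: vertex_less_iff[symmetric])

lemma restr_carrier [simp]: "restr G X \<in> carrier_mat (card X) n"
  by (simp add: restr_def)

lemma gradient_carrier [simp]: "gradient_mat G \<in> carrier_mat (card (arcs G)) n"
  by (simp add: gradient_mat_def)

lemma laplacian_carrier [simp]: "laplacian G s \<in> carrier_mat n n"
  by (rule carrier_matI) (simp_all add: laplacian_def gradient_mat_def)

lemma restr_mult_vec:
  assumes "X \<subseteq> verts G" "u \<in> carrier_vec n"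
  shows "restr G X *\<^sub>v u = vec (card X) (\<lambda>i. u $ pick X i)"
proof (rule eq_vecI)
  fix i assume "i < dim_vec (vec (card X) (\<lambda>i. u $ pick X i))"
  then show "(restr G X *\<^sub>v u) $ i = vec (card X) (\<lambda>i. u $ pick X i) $ i"
    using assms pick_less[of X i] by (auto simp: restr_def scalar_prod_def sum_delta_mult)
qed (simp add: restr_def)

text \<open>The transposed restriction is extension by zero; this covers the values on
  \<open>X\<close>, and \<open>restr_transpose_outside\<close> the remaining ones.\<close>

lemma restr_transpose_pick:
  assumes "X \<subseteq> verts G" "x \<in> carrier_vec (card X)" "i < card X"
  shows "(transpose_mat (restr G X) *\<^sub>v x) $ pick X i = x $ i"
proof -
  have "(transpose_mat (restr G X) *\<^sub>v x) $ pick X i =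
      (\<Sum>j = 0..<card X. (if pick X i = pick X j then 1 else 0) * x $ j)"
    using assms pick_less[of X i] by (simp add: restr_def scalar_prod_def)
  also have "\<dots> = (\<Sum>j = 0..<card X. (if j = i then 1 else 0) * x $ j)"
    using assms(3) by (intro sum.cong) (auto simp: pick_eq_iff)
  finally show ?thesis
    using assms by (simp add: sum_delta_mult)
qed

lemma restr_transpose_outside:
  assumes "x \<in> carrier_vec (card X)" "v < n" "v \<notin> X"
  shows "(transpose_mat (restr G X) *\<^sub>v x) $ v = 0"
proof -
  have "v \<noteq> pick X j" if "j < card X" for j
    using pick_in_set[of j X] that assms by auto
  then show ?thesis
    using assms by (simp add: restr_def scalar_prod_def)
qed

lemma restr_restr_transpose:
  assumes "X \<subseteq> verts G" "x \<in> carrier_vec (card X)"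
  shows "restr G X *\<^sub>v (transpose_mat (restr G X) *\<^sub>v x) = x"
proof -
  have "transpose_mat (restr G X) *\<^sub>v x \<in> carrier_vec n"
    using assms by (simp add: mult_mat_vec_carrier[of _ n "card X"])
  then show ?thesis
    using assms by (intro eq_vecI) (simp_all add: restr_mult_vec restr_transpose_pick)
qed

text \<open>Written as a product with restrictions, the block in the Green function becomes
  accessible to associativity and to the adjoint relation between restriction and extension by
  zero.\<close>

lemma submatrix_eq_restr:
  assumes A: "A \<in> carrier_mat n n" and "X \<subseteq> verts G" "Y \<subseteq> verts G"
  shows "submatrix A X Y = restr G X * A * transpose_mat (restr G Y)"
proof -
  \<comment> \<open>The dimensions of a \<open>submatrix\<close> count only the selected indices
    below the matrix size; for sets of vertices these are all of them.\<close>
  have card: "card {i. i < n \<and> i \<in> X} = card X" if "X \<subseteq> verts G" for X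
    using that by (intro arg_cong[where f = card]) (auto simp: vertex_less_iff)
  show ?thesis
  proof (rule eq_matI)
    fix i j
    assume "i < dim_row (restr G X * A * transpose_mat (restr G Y))"
      "j < dim_col (restr G X * A * transpose_mat (restr G Y))"
    then have ij: "i < card X" "j < card Y"
      by (auto simp: restr_def)
    have "(restr G X * A) $$ (i, v) = A $$ (pick X i, v)" if "v < n" for v
      using that ij assms pick_less[of X i] by (simp add: restr_def scalar_prod_def sum_delta_mult)
    then have "(restr G X * A * transpose_mat (restr G Y)) $$ (i, j) =
        (\<Sum>v = 0..<n. (if v = pick Y j then 1 else 0) * A $$ (pick X i, v))"
      using ij assms by (simp add: restr_def scalar_prod_def mult.commute)
    then show "submatrix A X Y $$ (i, j) = (restr G X * A * transpose_mat (restr G Y)) $$ (i, j)"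
      using ij assms pick_less[of Y j] by (simp add: submatrix_index card sum_delta_mult)
  qed (use assms in \<open>auto simp: dim_submatrix card restr_def\<close>)
qed

lemma gradient_mult_vec:
  assumes "u \<in> carrier_vec n" "e \<in> arcs G"
  shows "(gradient_mat G *\<^sub>v u) $ e = u $ tail G e - u $ head G e"
proof -
  have "(gradient_mat G *\<^sub>v u) $ e =
      (\<Sum>v = 0..<n. (if v = tail G e then 1 else if v = head G e then -1 else 0) * u $ v)"
    using assms arc_less_iff by (simp add: gradient_mat_def scalar_prod_def)
  \<comment> \<open>Without loops the tail and head differ, so the nested case distinction is a
    difference of two indicators.\<close>
  also have "\<dots> = (\<Sum>v = 0..<n. (if v = tail G e then 1 else 0) * u $ v -
      (if v = head G e then 1 else 0) * u $ v)"
    using no_loops[OF assms(2)] by (intro sum.cong) auto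
  finally show ?thesis
    using assms by (simp add: sum_subtractf sum_delta_mult)
qed

section \<open>The Dirichlet form\<close>

text \<open>Summation by parts: the transposed gradient moves over to \<open>w\<close>, and the
  diagonal matrix acts edge by edge.\<close>

lemma laplacian_bilinear:
  assumes "u \<in> carrier_vec n" "w \<in> carrier_vec n"
  shows "w \<bullet> (laplacian G s *\<^sub>v u) =
    (\<Sum>e\<in>arcs G. s $ e * (u $ tail G e - u $ head G e) * (w $ tail G e - w $ head G e))"
proof -
  let ?D = "gradient_mat G" and ?S = "mat_diag (card (arcs G)) (\<lambda>e. s $ e)"
  have S: "?S *\<^sub>v x = vec (card (arcs G)) (\<lambda>e. s $ e * x $ e)"
    if "x \<in> carrier_vec (card (arcs G))" for x
  proof (rule eq_vecI)
    fix i assume "i < dim_vec (vec (card (arcs G)) (\<lambda>e. s $ e * x $ e))"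
    then have i: "i < card (arcs G)"
      by simp
    then have "(?S *\<^sub>v x) $ i = (\<Sum>j = 0..<card (arcs G). (if i = j then s $ j else 0) * x $ j)"
      using that by (simp add: mat_diag_def scalar_prod_def)
    also have "\<dots> = (\<Sum>j = 0..<card (arcs G). (if j = i then 1 else 0) * (s $ j * x $ j))"
      by (intro sum.cong) auto
    also have "\<dots> = s $ i * x $ i"
      using i by (intro sum_delta_mult) auto
    finally show "(?S *\<^sub>v x) $ i = vec (card (arcs G)) (\<lambda>e. s $ e * x $ e) $ i"
      using i by simp
  qed (simp add: mat_diag_def)
  have Dt: "transpose_mat ?D \<in> carrier_mat n (card (arcs G))"
    by simp
  have Du: "?D *\<^sub>v u \<in> carrier_vec (card (arcs G))"
    using mult_mat_vec_carrier[OF gradient_carrier assms(1)] .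
  have SDu: "?S *\<^sub>v (?D *\<^sub>v u) \<in> carrier_vec (card (arcs G))"
    using mult_mat_vec_carrier[OF mat_diag_dim Du] .
  have "laplacian G s *\<^sub>v u = transpose_mat ?D *\<^sub>v (?S *\<^sub>v (?D *\<^sub>v u))"
    unfolding laplacian_def
      assoc_mult_mat_vec[OF mult_carrier_mat[OF Dt mat_diag_dim] gradient_carrier assms(1)]
      assoc_mult_mat_vec[OF Dt mat_diag_dim Du] ..
  then have "w \<bullet> (laplacian G s *\<^sub>v u) = (transpose_mat ?D *\<^sub>v (?S *\<^sub>v (?D *\<^sub>v u))) \<bullet> w"
    using comm_scalar_prod[OF assms(2) mult_mat_vec_carrier[OF Dt SDu]] by simp
  also have "\<dots> = (?S *\<^sub>v (?D *\<^sub>v u)) \<bullet> (?D *\<^sub>v w)"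
    using transpose_vec_mult_scalar[OF gradient_carrier assms(2) SDu] .
  also have "\<dots> = (\<Sum>e\<in>arcs G. (s $ e * (?D *\<^sub>v u) $ e) * (?D *\<^sub>v w) $ e)"
    unfolding S[OF Du] scalar_prod_def
    by (rule sum.cong) (simp_all add: gradient_mat_def arc_less_iff flip: arcs_numbered)
  finally show ?thesis
    using assms by (simp add: gradient_mult_vec)
qed

text \<open>A unit vector as test function in the bilinear form extracts one entry; only edges
  incident to \<open>v\<close> can contribute.\<close>

lemma laplacian_mult_vec:
  assumes "u \<in> carrier_vec n" "v < n"
  shows "(laplacian G s *\<^sub>v u) $ v =
    (\<Sum>e\<in>arcs G. s $ e * (u $ tail G e - u $ head G e) *
      ((if tail G e = v then 1 else 0) - (if head G e = v then 1 else 0)))"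
proof -
  have "(laplacian G s *\<^sub>v u) $ v = unit_vec n v \<bullet> (laplacian G s *\<^sub>v u)"
    using scalar_prod_left_unit[OF mult_mat_vec_carrier[OF laplacian_carrier assms(1)] assms(2)] by simp
  then show ?thesis
    using assms by (simp add: laplacian_bilinear)
qed

text \<open>A sum of nonnegative edge terms vanishes only if each term does, so \<open>u\<close>
  agrees at the two ends of every edge of \<open>H\<close>. The separate graph \<open>H\<close>
  permits zero weights elsewhere: it is \<open>G\<close> itself for \<open>\<sigma>\<close> and
  \<open>minus_graph\<close> for the inner conductivity.\<close>

lemma energy_zero_imp_constant:
  assumes H: "connected H" "arcs H \<subseteq> arcs G" "tail H = tail G" "head H = head G"
    and nonneg: "\<And>e. e \<in> arcs G \<Longrightarrow> 0 \<le> s $ e"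
    and pos: "\<And>e. e \<in> arcs H \<Longrightarrow> 0 < s $ e"
    and u: "u \<in> carrier_vec n" and energy: "u \<bullet> (laplacian G s *\<^sub>v u) = 0"
    and "x \<in> verts H" "y \<in> verts H"
  shows "u $ x = u $ y"
proof (rule connected_imp_constant[OF H(1)])
  fix e assume e: "e \<in> arcs H"
  have nonneg': "0 \<le> s $ f * (u $ tail G f - u $ head G f) * (u $ tail G f - u $ head G f)"
    if "f \<in> arcs G" for f
    using nonneg[OF that] by (simp add: mult.assoc)
  have "s $ e * (u $ tail G e - u $ head G e) * (u $ tail G e - u $ head G e) = 0"
    using energy e H(2) nonneg'
      sum_nonneg_eq_0_iff[OF finite_arcs, of "\<lambda>f. s $ f * (u $ tail G f - u $ head G f) * (u $ tail G f - u $ head G f)"]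
    unfolding laplacian_bilinear[OF u u] by blast
  then show "u $ tail H e = u $ head H e"
    using pos[OF e] H by simp
qed (use assms in auto)

text \<open>Used to annihilate energies: at each vertex either the test function or the Laplacian
  vanishes.\<close>

lemma scalar_prod_zero:
  assumes "y \<in> carrier_vec n" "\<And>v. v \<in> verts G \<Longrightarrow> w $ v = 0 \<or> y $ v = (0 :: real)"
  shows "w \<bullet> y = 0"
  unfolding scalar_prod_def using assms by (intro sum.neutral) (auto simp: vertex_less_iff)

section \<open>The vertex partition and uniqueness of potentials grounded on
  \<open>B\<close>\<close>

lemma verts_decomp: "verts G = B \<union> \<Omega>p \<union> \<Gamma> \<union> \<Omega>m"
  using partition_onD1[OF partition] by auto

lemma part_less:
  "v \<in> B \<Longrightarrow> v < n" "v \<in> \<Omega>p \<Longrightarrow> v < n" "v \<in> \<Gamma> \<Longrightarrow> v < n" "v \<in> \<Omega>m \<Longrightarrow> v < n"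
  unfolding vertex_less_iff[symmetric] by (simp_all add: verts_decomp)

lemma parts_nonempty: "B \<noteq> {}" "\<Gamma> \<noteq> {}"
  using partition_onD3[OF partition] by auto

lemma parts_disjoint:
  "B \<inter> \<Omega>p = {}" "B \<inter> \<Gamma> = {}" "B \<inter> \<Omega>m = {}" "\<Omega>p \<inter> \<Gamma> = {}" "\<Omega>p \<inter> \<Omega>m = {}" "\<Gamma> \<inter> \<Omega>m = {}"
  using disjointD[OF partition_onD2[OF partition]] distinct_parts by auto

lemma interface_subset: "\<Gamma> \<subseteq> verts G"
  using verts_decomp by auto

lemma edge_ends_subset: "e \<in> arcs G \<Longrightarrow> edge_ends G e \<subseteq> verts G"
  by (simp add: edge_ends_def)

text \<open>Zero energy makes \<open>u\<close> constant on the connected graph, and a vertex of the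
  nonempty set \<open>B\<close> fixes the constant.\<close>

lemma potential_zero:
  assumes "u \<in> carrier_vec n" "\<And>v. v \<in> B \<Longrightarrow> u $ v = 0"
    and "u \<bullet> (laplacian G \<sigma> *\<^sub>v u) = 0"
  shows "u = 0\<^sub>v n"
proof (rule eq_vecI)
  fix v assume "v < dim_vec (0\<^sub>v n :: real vec)"
  then have v: "v \<in> verts G" "v < n"
    by (simp_all add: vertex_less_iff)
  obtain b where b: "b \<in> B"
    using parts_nonempty by auto
  have "u $ v = u $ b"
    using connected_graph assms v b conductivity_pos less_imp_le verts_decomp
    by (intro energy_zero_imp_constant[of G \<sigma>]) auto
  then show "u $ v = 0\<^sub>v n $ v"
    using assms(2) b v by simp
qed (use assms in simp)

section \<open>Layer potentials\<close>

text \<open>A kernel vector extended by zero vanishes on \<open>B\<close> and has zero energy, hence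
  is zero.\<close>

lemma reduced_laplacian_invertible:
  "invertible_mat (submatrix (laplacian G \<sigma>) (verts G - B) (verts G - B))"
proof (rule injective_imp_invertible_mat)
  let ?V = "verts G - B"
  let ?R = "restr G ?V"
  have V: "?V \<subseteq> verts G"
    by auto
  have M: "submatrix (laplacian G \<sigma>) ?V ?V = ?R * laplacian G \<sigma> * transpose_mat ?R"
    using V by (simp add: submatrix_eq_restr)
  have RL: "?R * laplacian G \<sigma> \<in> carrier_mat (card ?V) n"
    by (rule mult_carrier_mat[OF restr_carrier laplacian_carrier])
  have Rt: "transpose_mat ?R \<in> carrier_mat n (card ?V)"
    by simp
  show "submatrix (laplacian G \<sigma>) ?V ?V \<in> carrier_mat (card ?V) (card ?V)"
    unfolding M by (rule mult_carrier_mat[OF RL Rt])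
  fix x assume x: "x \<in> carrier_vec (card ?V)"
    and zero: "submatrix (laplacian G \<sigma>) ?V ?V *\<^sub>v x = 0\<^sub>v (card ?V)"
  let ?u = "transpose_mat ?R *\<^sub>v x"
  have u: "?u \<in> carrier_vec n"
    by (rule mult_mat_vec_carrier[OF Rt x])
  have Lu: "laplacian G \<sigma> *\<^sub>v ?u \<in> carrier_vec n"
    by (rule mult_mat_vec_carrier[OF laplacian_carrier u])
  have "?R *\<^sub>v (laplacian G \<sigma> *\<^sub>v ?u) = 0\<^sub>v (card ?V)"
    using zero unfolding M assoc_mult_mat_vec[OF RL Rt x]
      assoc_mult_mat_vec[OF restr_carrier laplacian_carrier u] .
  \<comment> \<open>Extension by zero is adjoint to restriction, so the energy pairs
    \<open>x\<close> with the restricted Laplacian of \<open>?u\<close>, which is zero.\<close>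
  then have "?u \<bullet> (laplacian G \<sigma> *\<^sub>v ?u) = 0"
    using transpose_vec_mult_scalar[OF restr_carrier Lu x] x by simp
  moreover have "?u $ v = 0" if "v \<in> B" for v
    using that x by (intro restr_transpose_outside) (auto simp: part_less)
  ultimately have "?u = 0\<^sub>v n"
    using u by (intro potential_zero) auto
  then have "?R *\<^sub>v 0\<^sub>v n = x"
    using restr_restr_transpose[OF V x] by simp
  then show "x = 0\<^sub>v (card ?V)"
    using V pick_less[OF V] by (auto simp: restr_mult_vec intro!: eq_vecI)
qed

text \<open>The potential is the solution of the reduced system, extended by zero to
  \<open>B\<close>, for the source \<open>?f\<close> obtained from \<phi> by zero extension. Hence
  its Laplacian equals \<open>?f\<close> off \<open>B\<close>; on \<open>B\<close> the reduced
  system prescribes nothing.\<close>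

lemma layer_potential_mult:
  assumes \<phi>: "\<phi> \<in> carrier_vec (card \<Gamma>)"
  defines "u \<equiv> layer_potential G B \<Gamma> \<sigma> *\<^sub>v \<phi>"
  shows "u \<in> carrier_vec n"
    and "\<And>v. v \<in> B \<Longrightarrow> u $ v = 0"
    and "\<And>i. i < card \<Gamma> \<Longrightarrow> (laplacian G \<sigma> *\<^sub>v u) $ pick \<Gamma> i = \<phi> $ i"
    and "\<And>v. v \<in> \<Omega>p \<union> \<Omega>m \<Longrightarrow> (laplacian G \<sigma> *\<^sub>v u) $ v = 0"
proof -
  let ?V = "verts G - B"
  let ?R = "restr G ?V" and ?L = "laplacian G \<sigma>"
  let ?M = "submatrix ?L ?V ?V" and ?f = "transpose_mat (restr G \<Gamma>) *\<^sub>v \<phi>"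
  have V: "?V \<subseteq> verts G"
    by auto
  have Rt: "transpose_mat ?R \<in> carrier_mat n (card ?V)"
    by simp
  have RL: "?R * ?L \<in> carrier_mat (card ?V) n"
    by (rule mult_carrier_mat[OF restr_carrier laplacian_carrier])
  have M: "?M = ?R * ?L * transpose_mat ?R"
    using V by (simp add: submatrix_eq_restr)
  have Mc: "?M \<in> carrier_mat (card ?V) (card ?V)"
    unfolding M by (rule mult_carrier_mat[OF RL Rt])
  note inv = mat_inv[OF Mc reduced_laplacian_invertible]
  have f: "?f \<in> carrier_vec n"
    using \<phi> by (simp add: mult_mat_vec_carrier[of _ n "card \<Gamma>"])
  have Rf: "?R *\<^sub>v ?f \<in> carrier_vec (card ?V)"
    by (rule mult_mat_vec_carrier[OF restr_carrier f])
  \<comment> \<open>The values of the potential off \<open>B\<close>.\<close>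
  define x where "x = mat_inv ?M *\<^sub>v (?R *\<^sub>v ?f)"
  have x: "x \<in> carrier_vec (card ?V)"
    unfolding x_def by (rule mult_mat_vec_carrier[OF inv(1) Rf])
  have RtM: "transpose_mat ?R * mat_inv ?M \<in> carrier_mat n (card ?V)"
    by (rule mult_carrier_mat[OF Rt inv(1)])
  have green: "green_mat G B \<sigma> = transpose_mat ?R * mat_inv ?M * ?R"
    by (simp add: green_mat_def Let_def)
  have gc: "green_mat G B \<sigma> \<in> carrier_mat n n"
    unfolding green by (rule mult_carrier_mat[OF RtM restr_carrier])
  have \<Gamma>t: "transpose_mat (restr G \<Gamma>) \<in> carrier_mat n (card \<Gamma>)"
    by simp
  have u_eq: "u = transpose_mat ?R *\<^sub>v x"
    unfolding u_def layer_potential_def gamma0_def assoc_mult_mat_vec[OF gc \<Gamma>t \<phi>]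
    unfolding green assoc_mult_mat_vec[OF RtM restr_carrier f]
      assoc_mult_mat_vec[OF Rt inv(1) Rf] x_def ..
  show u: "u \<in> carrier_vec n"
    unfolding u_eq by (rule mult_mat_vec_carrier[OF Rt x])
  show "u $ v = 0" if "v \<in> B" for v
    unfolding u_eq using that x by (intro restr_transpose_outside) (auto simp: part_less)
  have Lu: "?L *\<^sub>v u \<in> carrier_vec n"
    by (rule mult_mat_vec_carrier[OF laplacian_carrier u])
  have "?R *\<^sub>v (?L *\<^sub>v u) = ?M *\<^sub>v x"
    unfolding M assoc_mult_mat_vec[OF RL Rt x] u_eq[symmetric]
      assoc_mult_mat_vec[OF restr_carrier laplacian_carrier u] ..
  also have "\<dots> = ?R *\<^sub>v ?f"
    unfolding x_def assoc_mult_mat_vec[OF Mc inv(1) Rf, symmetric] inv(2) using Rf by simp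
  finally have eq: "?R *\<^sub>v (?L *\<^sub>v u) = ?R *\<^sub>v ?f" .
  have source: "(?L *\<^sub>v u) $ v = ?f $ v" if v: "v \<in> ?V" for v
  proof -
    obtain i where i: "i < card ?V" "v = pick ?V i"
      using range_pick[OF finite_subset_verts[OF V] v] .
    from eq have "(?R *\<^sub>v (?L *\<^sub>v u)) $ i = (?R *\<^sub>v ?f) $ i"
      by simp
    then show ?thesis
      using i by (simp add: restr_mult_vec[OF V Lu] restr_mult_vec[OF V f])
  qed
  show "(?L *\<^sub>v u) $ pick \<Gamma> i = \<phi> $ i" if i: "i < card \<Gamma>" for i
  proof -
    have "pick \<Gamma> i \<in> ?V"
      using pick_in_set[of i \<Gamma>] i parts_disjoint interface_subset by blast
    then show ?thesis
      by (simp add: source restr_transpose_pick[OF interface_subset \<phi> i])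
  qed
  show "(?L *\<^sub>v u) $ v = 0" if v: "v \<in> \<Omega>p \<union> \<Omega>m" for v
  proof -
    have "v \<in> ?V" "v \<notin> \<Gamma>"
      using v parts_disjoint verts_decomp by blast+
    moreover have "v < n"
      using v by (auto simp: part_less)
    ultimately show ?thesis
      using source restr_transpose_outside[OF \<phi>] by simp
  qed
qed

section \<open>Invertibility of the single layer operator\<close>

lemma layer_potential_carrier: "layer_potential G B \<Gamma> \<sigma> \<in> carrier_mat n (card \<Gamma>)"
  by (rule carrier_matI) (simp_all add: layer_potential_def green_mat_def gamma0_def restr_def Let_def)

lemma single_layer_carrier: "single_layer G B \<Gamma> \<sigma> \<in> carrier_mat (card \<Gamma>) (card \<Gamma>)"
  unfolding single_layer_def gamma0_def by (rule mult_carrier_mat[OF restr_carrier layer_potential_carrier])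

lemma single_layer_mult:
  assumes \<phi>: "\<phi> \<in> carrier_vec (card \<Gamma>)"
  shows "single_layer G B \<Gamma> \<sigma> *\<^sub>v \<phi> =
    vec (card \<Gamma>) (\<lambda>i. (layer_potential G B \<Gamma> \<sigma> *\<^sub>v \<phi>) $ pick \<Gamma> i)"
  unfolding single_layer_def gamma0_def
    assoc_mult_mat_vec[OF restr_carrier layer_potential_carrier \<phi>]
  by (rule restr_mult_vec[OF interface_subset layer_potential_mult(1)[OF \<phi>]])

lemma interface_pick:
  assumes "v \<in> \<Gamma>"
  obtains i where "i < card \<Gamma>" "v = pick \<Gamma> i"
  using range_pick[OF finite_subset_verts[OF interface_subset] assms] .

text \<open>A density in the kernel has a potential with zero trace on \<Gamma>. Its energy then
  vanishes, so the potential is zero, and so is the density, being its Laplacian on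
  \<Gamma>.\<close>

lemma single_layer_invertible: "invertible_mat (single_layer G B \<Gamma> \<sigma>)"
proof (rule injective_imp_invertible_mat[OF single_layer_carrier])
  fix \<phi> assume \<phi>: "\<phi> \<in> carrier_vec (card \<Gamma>)"
    and zero: "single_layer G B \<Gamma> \<sigma> *\<^sub>v \<phi> = 0\<^sub>v (card \<Gamma>)"
  let ?u = "layer_potential G B \<Gamma> \<sigma> *\<^sub>v \<phi>"
  note pot = layer_potential_mult[OF \<phi>]
  have trace: "?u $ pick \<Gamma> i = 0" if "i < card \<Gamma>" for i
    using arg_cong[OF zero, of "\<lambda>x. x $ i"] that by (simp add: single_layer_mult[OF \<phi>])
  \<comment> \<open>The potential vanishes on \<open>B\<close> and \<Gamma>, its Laplacian in
    \<open>\<Omega>p\<close> and \<open>\<Omega>m\<close>.\<close>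
  have "?u $ v = 0 \<or> (laplacian G \<sigma> *\<^sub>v ?u) $ v = 0" if "v \<in> verts G" for v
  proof (cases "v \<in> \<Gamma>")
    case True
    then show ?thesis
      using trace by (auto elim: interface_pick)
  next
    case False
    then show ?thesis
      using that pot(2,4) by (auto simp: verts_decomp)
  qed
  then have "?u = 0\<^sub>v n"
    using pot(1,2)
    by (intro potential_zero scalar_prod_zero mult_mat_vec_carrier[OF laplacian_carrier]) auto
  then have "(laplacian G \<sigma> *\<^sub>v 0\<^sub>v n) $ pick \<Gamma> i = \<phi> $ i" if "i < card \<Gamma>" for i
    using pot(3)[OF that] by simp
  then show "\<phi> = 0\<^sub>v (card \<Gamma>)"
    using \<phi> pick_less[OF interface_subset]
    by (intro eq_vecI) (auto simp: laplacian_mult_vec)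
qed

section \<open>The inner conductivity\<close>

abbreviation (input) "\<sigma>p \<equiv> component_mult pp \<sigma>"
abbreviation (input) "\<sigma>m \<equiv> component_mult pm \<sigma>"

lemma conductivity_split:
  assumes "e \<in> arcs G"
  shows "\<sigma>p $ e = pp $ e * \<sigma> $ e" "\<sigma>m $ e = pm $ e * \<sigma> $ e" "\<sigma>p $ e + \<sigma>m $ e = \<sigma> $ e"
proof -
  show 1: "\<sigma>p $ e = pp $ e * \<sigma> $ e" "\<sigma>m $ e = pm $ e * \<sigma> $ e"
    using assms pp_carrier pm_carrier conductivity_carrier
    by (simp_all add: arc_less_iff index_component_mult)
  show "\<sigma>p $ e + \<sigma>m $ e = \<sigma> $ e"
    unfolding 1 using pp_pm_sum[OF assms] by (simp flip: distrib_right)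
qed

lemma sigma_minus_nonneg: "e \<in> arcs G \<Longrightarrow> 0 \<le> \<sigma>m $ e"
  using pm_range[of e] conductivity_pos[of e] by (simp add: conductivity_split)

text \<open>An edge with an end in \<open>B\<close> or \<open>\<Omega>p\<close> has
  \<open>pp\<close> equal to 1, which leaves nothing for \<open>pm\<close>.\<close>

lemma sigma_minus_support:
  assumes e: "e \<in> arcs G" and "\<sigma>m $ e \<noteq> 0"
  shows "edge_ends G e \<subseteq> \<Gamma> \<union> \<Omega>m"
proof (rule ccontr)
  assume "\<not> edge_ends G e \<subseteq> \<Gamma> \<union> \<Omega>m"
  then have "edge_ends G e \<inter> (B \<union> \<Omega>p) \<noteq> {}"
    using edge_ends_subset[OF e] verts_decomp by blast
  then have "pm $ e = 0"
    using pp_one[OF e] pp_pm_sum[OF e] by simp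
  then show False
    using assms by (simp add: conductivity_split)
qed

text \<open>Every edge incident to \<open>v\<close> has \<open>pm\<close> equal to 1, so the
  contributing terms of both sums coincide.\<close>

lemma laplacian_minus_interior:
  assumes "u \<in> carrier_vec n" "v \<in> \<Omega>m"
  shows "(laplacian G \<sigma>m *\<^sub>v u) $ v = (laplacian G \<sigma> *\<^sub>v u) $ v"
proof -
  have v: "v < n"
    using assms(2) by (auto simp: part_less)
  have "\<sigma>m $ e = \<sigma> $ e" if "e \<in> arcs G" "tail G e = v \<or> head G e = v" for e
    using pm_one[OF that(1)] that assms(2) by (auto simp: conductivity_split edge_ends_def)
  then show ?thesis
    unfolding laplacian_mult_vec[OF assms(1) v] by (intro sum.cong) auto
qed

text \<open>No edge incident to \<open>v\<close> carries inner conductivity.\<close>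

lemma laplacian_minus_outside:
  assumes "u \<in> carrier_vec n" "v \<in> B \<union> \<Omega>p"
  shows "(laplacian G \<sigma>m *\<^sub>v u) $ v = 0"
proof -
  have v: "v < n"
    using assms(2) by (auto simp: part_less)
  have "v \<notin> \<Gamma> \<union> \<Omega>m"
    using assms(2) parts_disjoint by blast
  then have "\<sigma>m $ e = 0" if "e \<in> arcs G" "tail G e = v \<or> head G e = v" for e
    using sigma_minus_support[OF that(1)] that(2) by (auto simp: edge_ends_def)
  then show ?thesis
    unfolding laplacian_mult_vec[OF assms(1) v] by (intro sum.neutral) auto
qed

lemma laplacian_split:
  assumes "u \<in> carrier_vec n" "v < n"
  shows "(laplacian G \<sigma>p *\<^sub>v u) $ v + (laplacian G \<sigma>m *\<^sub>v u) $ v = (laplacian G \<sigma> *\<^sub>v u) $ v"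
  unfolding laplacian_mult_vec[OF assms] sum.distrib[symmetric]
  by (intro sum.cong) (simp_all flip: distrib_right conductivity_split(3))

lemma minus_energy_zero_imp_constant:
  assumes "connected (minus_graph G \<Gamma> \<Omega>m \<sigma>m)" "u \<in> carrier_vec n"
    and "u \<bullet> (laplacian G \<sigma>m *\<^sub>v u) = 0"
    and "x \<in> \<Gamma> \<union> \<Omega>m" "y \<in> \<Gamma> \<union> \<Omega>m"
  shows "u $ x = u $ y"
  using assms sigma_minus_nonneg
  by (intro energy_zero_imp_constant[of "minus_graph G \<Gamma> \<Omega>m \<sigma>m" \<sigma>m]) (auto simp: minus_graph_def)

text \<open>Both directions are energy arguments for the inner conductivity: the first tests with
  \<open>u\<close> itself, the second with \<open>u\<close> minus its boundary constant, cut off to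
  \<open>\<Omega>m\<close>.\<close>

lemma minus_derivative_zero_iff:
  assumes conn: "connected (minus_graph G \<Gamma> \<Omega>m \<sigma>m)" and u: "u \<in> carrier_vec n"
    and harmonic: "\<And>v. v \<in> \<Omega>m \<Longrightarrow> (laplacian G \<sigma> *\<^sub>v u) $ v = 0"
  shows "(\<forall>v\<in>\<Gamma>. (laplacian G \<sigma>m *\<^sub>v u) $ v = 0) \<longleftrightarrow> (\<exists>c. \<forall>v\<in>\<Gamma>. u $ v = c)"
proof
  assume zero: "\<forall>v\<in>\<Gamma>. (laplacian G \<sigma>m *\<^sub>v u) $ v = 0"
  \<comment> \<open>This holds on \<Gamma> by assumption, in \<open>\<Omega>m\<close> by
    harmonicity, and elsewhere because there is no inner conductivity.\<close>
  have "(laplacian G \<sigma>m *\<^sub>v u) $ v = 0" if "v \<in> verts G" for v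
    using that zero harmonic laplacian_minus_interior[OF u] laplacian_minus_outside[OF u]
    by (auto simp: verts_decomp)
  then have "u \<bullet> (laplacian G \<sigma>m *\<^sub>v u) = 0"
    using u by (intro scalar_prod_zero mult_mat_vec_carrier[OF laplacian_carrier]) auto
  with conn u have "u $ x = u $ y" if "x \<in> \<Gamma>" "y \<in> \<Gamma>" for x y
    using minus_energy_zero_imp_constant that by blast
  then show "\<exists>c. \<forall>v\<in>\<Gamma>. u $ v = c"
    by metis
next
  assume "\<exists>c. \<forall>v\<in>\<Gamma>. u $ v = c"
  then obtain c where c: "\<And>v. v \<in> \<Gamma> \<Longrightarrow> u $ v = c"
    by blast
  \<comment> \<open>\<open>w\<close> differs from \<open>u\<close> by a constant on every edge with positive inner conductivity.\<close>
  define w where "w = vec n (\<lambda>v. if v \<in> \<Omega>m then u $ v - c else 0)"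
  have w: "w \<in> carrier_vec n"
    by (simp add: w_def)
  have w_index: "w $ v = (if v \<in> \<Omega>m then u $ v - c else 0)" if "v \<in> verts G" for v
    using that by (simp add: w_def vertex_less_iff)
  have w_minus: "w $ v = u $ v - c" if "v \<in> \<Gamma> \<union> \<Omega>m" for v
    using that c parts_disjoint verts_decomp by (subst w_index) auto
  have "w \<bullet> (laplacian G \<sigma>m *\<^sub>v w) = w \<bullet> (laplacian G \<sigma>m *\<^sub>v u)"
    unfolding laplacian_bilinear[OF w w] laplacian_bilinear[OF u w]
  proof (rule sum.cong)
    fix e assume e: "e \<in> arcs G"
    show "\<sigma>m $ e * (w $ tail G e - w $ head G e) * (w $ tail G e - w $ head G e) =
      \<sigma>m $ e * (u $ tail G e - u $ head G e) * (w $ tail G e - w $ head G e)"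
    proof (cases "\<sigma>m $ e = 0")
      case False
      with sigma_minus_support[OF e] show ?thesis
        by (simp add: w_minus edge_ends_def)
    qed simp
  qed simp
  \<comment> \<open>The cutoff \<open>w\<close> vanishes outside \<open>\<Omega>m\<close>, and
    inside it the inner Laplacian of \<open>u\<close> is the full one, which is zero.\<close>
  also have "\<dots> = 0"
    using u harmonic laplacian_minus_interior[OF u] w_index
    by (intro scalar_prod_zero mult_mat_vec_carrier[OF laplacian_carrier]) auto
  finally have w_energy: "w \<bullet> (laplacian G \<sigma>m *\<^sub>v w) = 0" .
  \<comment> \<open>By zero energy \<open>w\<close> is constant on
    \<open>\<Gamma> \<union> \<Omega>m\<close>; a vertex of \<Gamma>, where \<open>w\<close> is
    zero, fixes this constant.\<close>
  obtain g where g: "g \<in> \<Gamma>"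
    using parts_nonempty by auto
  have "u $ v = c" if "v \<in> \<Gamma> \<union> \<Omega>m" for v
    using minus_energy_zero_imp_constant[OF conn w w_energy that, of g] g that w_minus c by simp
  then have flat: "\<sigma>m $ e * (u $ tail G e - u $ head G e) = 0" if "e \<in> arcs G" for e
    using sigma_minus_support[OF that] by (cases "\<sigma>m $ e = 0") (simp_all add: edge_ends_def)
  show "\<forall>v\<in>\<Gamma>. (laplacian G \<sigma>m *\<^sub>v u) $ v = 0"
    using interface_subset by (auto simp: laplacian_mult_vec[OF u] flat vertex_less_iff)
qed

section \<open>The Neumann-Poincare operator and its eigenvectors for -1/2\<close>

lemma neumann_poincare_carrier:
  "neumann_poincare G B \<Gamma> \<sigma> pp pm \<in> carrier_mat (card \<Gamma>) (card \<Gamma>)"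
  using layer_potential_carrier
  by (intro carrier_matI) (simp_all add: neumann_poincare_def gamma1_minus_def restr_def)

text \<open>
  As the two normal derivatives differ by \<open>\<phi>\<close>, their mean is the inner one minus \<open>\<phi>\<close>/2.
\<close>

lemma neumann_poincare_mult:
  assumes \<phi>: "\<phi> \<in> carrier_vec (card \<Gamma>)" and i: "i < card \<Gamma>"
  shows "(neumann_poincare G B \<Gamma> \<sigma> pp pm *\<^sub>v \<phi>) $ i =
    (laplacian G \<sigma>m *\<^sub>v (layer_potential G B \<Gamma> \<sigma> *\<^sub>v \<phi>)) $ pick \<Gamma> i - \<phi> $ i / 2"
proof -
  let ?u = "layer_potential G B \<Gamma> \<sigma> *\<^sub>v \<phi>"
  let ?P = "restr G \<Gamma> * laplacian G \<sigma>p" and ?M = "restr G \<Gamma> * laplacian G \<sigma>m"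
  note pot = layer_potential_mult[OF \<phi>]
  have carr: "restr G \<Gamma> * laplacian G s \<in> carrier_mat (card \<Gamma>) n" for s
    by (rule mult_carrier_mat[OF restr_carrier laplacian_carrier])
  have ix: "(restr G \<Gamma> * laplacian G s *\<^sub>v ?u) $ i = (laplacian G s *\<^sub>v ?u) $ pick \<Gamma> i" for s
    using i unfolding assoc_mult_mat_vec[OF restr_carrier laplacian_carrier pot(1)]
    by (simp add: restr_mult_vec[OF interface_subset mult_mat_vec_carrier[OF laplacian_carrier pot(1)]])
  have "(1/2) \<cdot>\<^sub>m (- ?P + ?M) \<in> carrier_mat (card \<Gamma>) n"
    using carr by simp
  then have "(neumann_poincare G B \<Gamma> \<sigma> pp pm *\<^sub>v \<phi>) $ i = (((1/2) \<cdot>\<^sub>m (- ?P + ?M)) *\<^sub>v ?u) $ i"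
    unfolding neumann_poincare_def gamma1_plus_def gamma1_minus_def
    using assoc_mult_mat_vec[OF _ layer_potential_carrier \<phi>] by simp
  also have "\<dots> = 1/2 * ((- ?P + ?M) *\<^sub>v ?u) $ i"
    using smult_mat_mult_vec_index[OF _ pot(1) i, of "- ?P + ?M" "1/2"] carr by simp
  also have "((- ?P + ?M) *\<^sub>v ?u) $ i = (?M *\<^sub>v ?u) $ i - (?P *\<^sub>v ?u) $ i"
    by (rule diff_mat_mult_vec_index[OF carr carr pot(1) i])
  finally show ?thesis
    using laplacian_split[OF pot(1) pick_less[OF interface_subset i]] pot(3)[OF i]
    by (simp add: ix)
qed

text \<open>The term -\<phi>/2 in the operator cancels against the eigenvalue and leaves the inner
  derivative alone. Constancy of the potential on \<Gamma> is then a condition on its trace, which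
  is the single layer operator applied to \<phi>.\<close>

lemma neumann_poincare_eigen_iff:
  assumes "connected (minus_graph G \<Gamma> \<Omega>m \<sigma>m)" and \<phi>: "\<phi> \<in> carrier_vec (card \<Gamma>)"
  shows "neumann_poincare G B \<Gamma> \<sigma> pp pm *\<^sub>v \<phi> = (-1/2) \<cdot>\<^sub>v \<phi> \<longleftrightarrow>
    (\<exists>c. single_layer G B \<Gamma> \<sigma> *\<^sub>v \<phi> = c \<cdot>\<^sub>v ones_vec (card \<Gamma>))"
proof -
  let ?u = "layer_potential G B \<Gamma> \<sigma> *\<^sub>v \<phi>"
  note pot = layer_potential_mult[OF \<phi>]
  have all: "(\<forall>v\<in>\<Gamma>. Q v) \<longleftrightarrow> (\<forall>i<card \<Gamma>. Q (pick \<Gamma> i))" for Q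
    using pick_in_set[of _ \<Gamma>] by (auto elim: interface_pick)
  have "neumann_poincare G B \<Gamma> \<sigma> pp pm *\<^sub>v \<phi> = (-1/2) \<cdot>\<^sub>v \<phi> \<longleftrightarrow>
      (\<forall>v\<in>\<Gamma>. (laplacian G \<sigma>m *\<^sub>v ?u) $ v = 0)"
    using neumann_poincare_carrier \<phi> unfolding all vec_eq_iff
    by (simp add: neumann_poincare_mult[OF \<phi>] del: index_mult_mat_vec)
  also have "\<dots> \<longleftrightarrow> (\<exists>c. \<forall>v\<in>\<Gamma>. ?u $ v = c)"
    using minus_derivative_zero_iff[OF assms(1) pot(1)] pot(4) by blast
  also have "\<dots> \<longleftrightarrow> (\<exists>c. single_layer G B \<Gamma> \<sigma> *\<^sub>v \<phi> = c \<cdot>\<^sub>v ones_vec (card \<Gamma>))"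
    unfolding all by (simp add: vec_eq_iff single_layer_mult[OF \<phi>] ones_vec_def)
  finally show ?thesis .
qed

end

section \<open>The eigenspace obtained by inverting the single layer operator\<close>

theorem lemma4p2:
  fixes G :: "(nat, nat) pre_digraph"
    and B \<Omega>p \<Gamma> \<Omega>m :: "nat set"
    and \<sigma> pp pm :: "real vec"
  assumes "conductivity_network G B \<Omega>p \<Gamma> \<Omega>m \<sigma> pp pm"
    and "connected (minus_graph G \<Gamma> \<Omega>m (component_mult pm \<sigma>))"
  shows "eigenvalue (neumann_poincare G B \<Gamma> \<sigma> pp pm) (- 1/2) \<and>
    eigenspace (neumann_poincare G B \<Gamma> \<sigma> pp pm) (- 1/2) =
      {c \<cdot>\<^sub>v (mat_inv (single_layer G B \<Gamma> \<sigma>) *\<^sub>v ones_vec (card \<Gamma>)) | c :: real. True}"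
proof -
  interpret conductivity_network G B \<Omega>p \<Gamma> \<Omega>m \<sigma> pp pm
    by fact
  let ?k = "card \<Gamma>"
  let ?S = "single_layer G B \<Gamma> \<sigma>" and ?D = "neumann_poincare G B \<Gamma> \<sigma> pp pm"
  let ?\<psi> = "mat_inv ?S *\<^sub>v ones_vec ?k"
  note inv = mat_inv[OF single_layer_carrier single_layer_invertible]
  have one: "ones_vec ?k \<in> carrier_vec ?k"
    by (simp add: ones_vec_def)
  have \<psi>: "?\<psi> \<in> carrier_vec ?k"
    by (rule mult_mat_vec_carrier[OF inv(1) one])
  have S\<psi>: "?S *\<^sub>v ?\<psi> = ones_vec ?k"
    using assoc_mult_mat_vec[OF single_layer_carrier inv(1) one] inv(2) one by simp
  \<comment> \<open>Invertibility of \<open>?S\<close> turns the trace condition for eigenvectors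
    into membership in the line through \<open>?\<psi>\<close>, with the same constant
    \<open>c\<close>.\<close>
  have solve: "?S *\<^sub>v \<phi> = c \<cdot>\<^sub>v ones_vec ?k \<longleftrightarrow> \<phi> = c \<cdot>\<^sub>v ?\<psi>" if \<phi>: "\<phi> \<in> carrier_vec ?k" for \<phi> c
  proof
    assume "?S *\<^sub>v \<phi> = c \<cdot>\<^sub>v ones_vec ?k"
    then have "mat_inv ?S *\<^sub>v (?S *\<^sub>v \<phi>) = c \<cdot>\<^sub>v ?\<psi>"
      using mult_mat_vec[OF inv(1) one] by simp
    then show "\<phi> = c \<cdot>\<^sub>v ?\<psi>"
      using assoc_mult_mat_vec[OF inv(1) single_layer_carrier \<phi>] inv(3) \<phi> by simp
  next
    assume "\<phi> = c \<cdot>\<^sub>v ?\<psi>"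
    then show "?S *\<^sub>v \<phi> = c \<cdot>\<^sub>v ones_vec ?k"
      using mult_mat_vec[OF single_layer_carrier \<psi>] S\<psi> by simp
  qed
  have dim: "dim_row ?D = ?k"
    using neumann_poincare_carrier by simp
  have space: "eigenspace ?D (- 1/2) = {c \<cdot>\<^sub>v ?\<psi> | c :: real. True}"
    using neumann_poincare_eigen_iff[OF assms(2)] solve \<psi>
    by (auto simp: eigenspace_def dim)
  have "?\<psi> \<noteq> 0\<^sub>v ?k"
  proof
    assume "?\<psi> = 0\<^sub>v ?k"
    \<comment> \<open>In this form \<open>solve\<close> applies with constant 0 and makes the ones
      vector zero, which is impossible as \<Gamma> is nonempty.\<close>
    then have "?\<psi> = 0 \<cdot>\<^sub>v ?\<psi>"
      by auto
    then have "ones_vec ?k = 0 \<cdot>\<^sub>v ones_vec ?k"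
      using solve[OF \<psi>, of 0] S\<psi> by simp
    moreover have "0 < ?k"
      using parts_nonempty finite_subset_verts[OF interface_subset] by (simp add: card_gt_0_iff)
    ultimately show False
      by (auto simp: ones_vec_def vec_eq_iff)
  qed
  \<comment> \<open>The trace of the potential of \<open>?\<psi>\<close> is the ones vector itself,
    so the constant is 1.\<close>
  moreover have "?D *\<^sub>v ?\<psi> = (- 1/2) \<cdot>\<^sub>v ?\<psi>"
    unfolding neumann_poincare_eigen_iff[OF assms(2) \<psi>] S\<psi> by (rule exI[of _ 1]) simp
  ultimately have "eigenvalue ?D (- 1/2)"
    using \<psi> by (auto simp: eigenvalue_def eigenvector_def dim)
  with space show ?thesis
    by blast
qed

end
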